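(* For every integer $s\geq 1$, the complete bipartite graph $K_{2s,2s}$ satisfies $\mathrm{av}(K_{2s,2s})=2s-1$.
   Context: An Eulerian circuit is a closed trail traversing every edge exactly once. For an Eulerian graph with $m$ edges and vertex $x$, two Eulerian circuits $x,v_1,\ldots,v_{m-1},x$ and $x,w_1,\ldots,w_{m-1},x$ are avoiding if for each $1\le i\le m-1$, $v_i\ne w_i$ and $v_i,w_i$ are non-adjacent; a set of Eulerian circuits is mutually avoiding if they are pairwise avoiding. The avoidance index $\mathrm{av}(G)$ of an Eulerian graph $G$ is the largest $k$ such that for every vertex $x$ there is a set of $k$ mutually avoiding Eulerian circuits starting and ending at $x$. *)

theory Defs
  imports Main
begin

text \<open>Finite simple graphs: every edge is a two-element set of vertices.\<close>

record 'a graph =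
  verts :: "'a set"
  edges :: "'a set set"

definition simple_graph :: "'a graph \<Rightarrow> bool" where
  "simple_graph G \<longleftrightarrow> finite (verts G) \<and> (\<forall>e\<in>edges G. e \<subseteq> verts G \<and> card e = 2)"

definition adjacent :: "'a graph \<Rightarrow> 'a \<Rightarrow> 'a \<Rightarrow> bool" where
  "adjacent G u v \<longleftrightarrow> {u, v} \<in> edges G"

fun walk_edges :: "'a list \<Rightarrow> 'a set list" where
  "walk_edges [] = []"
| "walk_edges [v] = []"
| "walk_edges (u # v # vs) = {u, v} # walk_edges (v # vs)"

definition walk :: "'a graph \<Rightarrow> 'a list \<Rightarrow> bool" where
  "walk G c \<longleftrightarrow> c \<noteq> [] \<and> set c \<subseteq> verts G \<and> set (walk_edges c) \<subseteq> edges G"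

definition trail :: "'a graph \<Rightarrow> 'a list \<Rightarrow> bool" where
  "trail G c \<longleftrightarrow> walk G c \<and> distinct (walk_edges c)"

text \<open>
  A circuit is given by its full vertex sequence, with the base vertex \<open>x\<close> listed both first and
  last; it thus has length \<open>card (edges G) + 1\<close>. Since the graph is simple, the vertex sequence
  determines the sequence of edges.
\<close>

definition eulerian_circuit :: "'a graph \<Rightarrow> 'a \<Rightarrow> 'a list \<Rightarrow> bool" where
  "eulerian_circuit G x c \<longleftrightarrow>
     trail G c \<and> hd c = x \<and> last c = x \<and> set (walk_edges c) = edges G"

definition avoiding :: "'a graph \<Rightarrow> 'a list \<Rightarrow> 'a list \<Rightarrow> bool" where
  "avoiding G c d \<longleftrightarrow>
     (\<forall>i\<in>{1..card (edges G) - 1}. c ! i \<noteq> d ! i \<and> \<not> adjacent G (c ! i) (d ! i))"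

definition mutually_avoiding :: "'a graph \<Rightarrow> 'a list set \<Rightarrow> bool" where
  "mutually_avoiding G C \<longleftrightarrow> pairwise (avoiding G) C"

definition avoidance_index :: "'a graph \<Rightarrow> nat" where
  "avoidance_index G =
     (GREATEST k. \<forall>x\<in>verts G. \<exists>C. finite C \<and> card C = k \<and>
        (\<forall>c\<in>C. eulerian_circuit G x c) \<and> mutually_avoiding G C)"

definition complete_bipartite :: "nat \<Rightarrow> nat \<Rightarrow> (nat + nat) graph" where
  "complete_bipartite m n =
     \<lparr>verts = Inl ` {..<m} \<union> Inr ` {..<n},
      edges = {{Inl i, Inr j} | i j. i < m \<and> j < n}\<rparr>"

lemma simple_graph_complete_bipartite: "simple_graph (complete_bipartite m n)"
  by (auto simp: simple_graph_def complete_bipartite_def)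

end

theory Submission
  imports Defs "HOL-Combinatorics.Transposition"
begin

text \<open>
  Upper bound: a circuit from \<open>x\<close> cannot be back at \<open>x\<close> after two steps, so the third vertices of
  mutually avoiding circuits are distinct vertices of the side of \<open>x\<close> other than \<open>x\<close>.

  Lower bound: write \<open>n = 2 * s\<close>, number both sides by \<open>0, \<dots>, n - 1\<close> with \<open>x = 0\<close>, and list the
  vertices of the side of \<open>x\<close> visited by a circuit as \<open>a 0, a 1, \<dots>\<close>. If every aligned block
  \<open>a (t * n), \<dots>, a (t * n + n - 1)\<close> and also every block shifted by one to the left is a permutation
  of the side, then an Eulerian circuit arises by using one fixed opposite vertex in all the steps
  \<open>a j \<rightarrow> a (j + 1)\<close> with \<open>j\<close> even inside an aligned block, one for those with \<open>j\<close> odd inside a shifted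
  block, and different ones for different blocks. The block condition says that all aligned
  blocks end in the same vertex and is otherwise free. Letting the blocks of the \<open>k\<close>-th circuit
  (\<open>1 \<le> k < n\<close>) end in \<open>k\<close>, it remains to arrange the first block by a cyclic Latin square of order
  \<open>n - 1\<close> preceded by \<open>0\<close>, the others by a cyclic Latin square of order \<open>n\<close>, and to rotate the
  opposite vertices by \<open>k\<close>.
\<close>

section \<open>Index sequences of the two sides\<close>

text \<open>For \<open>0 < k < n\<close> the offsets make the value \<open>k\<close> whenever
  \<open>j mod n = n - 1\<close>, so all aligned blocks end in \<open>k\<close>. Raising the
  residues modulo \<open>n - 1\<close> by one keeps \<open>0\<close> for position 0 alone in the
  first block.\<close>

definition left_index :: "nat \<Rightarrow> nat \<Rightarrow> nat \<Rightarrow> nat" where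
  "left_index n k j =
     (if j = 0 then 0 else if j < n then (k + j - 1) mod (n - 1) + 1 else (k + 1 + j) mod n)"

text \<open>For even \<open>n\<close>, the quotient \<open>(j + 1) div n\<close> is the number of
  the aligned block of \<open>j\<close> if \<open>j\<close> is even, and of its shifted block if
  \<open>j\<close> is odd.\<close>

definition right_index :: "nat \<Rightarrow> nat \<Rightarrow> nat \<Rightarrow> nat" where
  "right_index n k j = (2 * ((j + 1) div n) + j mod 2 + k) mod n"

lemma ex_mod_eq_in_window:
  fixes m :: nat
  assumes "u < m"
  shows "\<exists>j. p \<le> j \<and> j < p + m \<and> (q + j) mod m = u"
proof -
  define r where "r = (q + p) mod m"
  have r: "r < m" using assms by (simp add: r_def)
  \<comment> \<open>The distance from \<open>r\<close> forward to \<open>u\<close> around the cycle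
    of length \<open>m\<close>.\<close>
  define d where "d = (if r \<le> u then u - r else u + m - r)"
  have "d < m" using r assms by (auto simp: d_def)
  moreover have "(q + (p + d)) mod m = u"
  proof -
    have "(q + (p + d)) mod m = (r + d) mod m"
      by (simp add: r_def mod_add_left_eq add.assoc[symmetric])
    also have "\<dots> = u" using r assms by (auto simp: d_def)
    finally show ?thesis .
  qed
  ultimately show ?thesis by (intro exI[of _ "p + d"]) auto
qed

lemma mod_add_right_cancel_less:
  fixes k l c m :: nat
  assumes "(k + c) mod m = (l + c) mod m" "k < m" "l < m"
  shows "k = l"
proof -
  have "int m dvd (int k + int c) - (int l + int c)"
    using assms(1) by (metis mod_eq_dvd_iff of_nat_add of_nat_mod)
  then have "int m dvd int k - int l" by simp
  then have "int k mod int m = int l mod int m" by (simp add: mod_eq_dvd_iff)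
  then show ?thesis using assms(2,3) by simp
qed

lemma left_index_less:
  assumes "2 \<le> n"
  shows "left_index n k j < n"
proof -
  have "(k + j - 1) mod (n - 1) < n - 1" using assms by (intro mod_less_divisor) simp
  then have "(k + j - 1) mod (n - 1) + 1 < n" by linarith
  then show ?thesis using assms by (simp add: left_index_def)
qed

lemma right_index_less: "0 < n \<Longrightarrow> right_index n k j < n"
  by (simp add: right_index_def)

lemma left_index_inj:
  assumes "left_index n k j = left_index n l j" "0 < j" "0 < k" "k < n" "0 < l" "l < n"
  shows "k = l"
proof (cases "j < n")
  case True
  then have "((k - 1) + j) mod (n - 1) = ((l - 1) + j) mod (n - 1)"
    using assms by (simp add: left_index_def)
  then have "k - 1 = l - 1"
    by (rule mod_add_right_cancel_less) (use assms in auto)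
  then show ?thesis using assms by simp
next
  case False
  then have "(k + (1 + j)) mod n = (l + (1 + j)) mod n"
    using assms by (simp add: left_index_def)
  then show ?thesis by (rule mod_add_right_cancel_less) (use assms in auto)
qed

lemma right_index_inj:
  assumes "right_index n k j = right_index n l j" "k < n" "l < n"
  shows "k = l"
proof (rule mod_add_right_cancel_less)
  show "(k + (2 * ((j + 1) div n) + j mod 2)) mod n = (l + (2 * ((j + 1) div n) + j mod 2)) mod n"
    using assms(1) by (simp add: right_index_def add_ac)
qed (use assms in auto)

text \<open>At \<open>j = n - 1\<close> both formulas give \<open>k\<close>. Hence each shifted
  block with \<open>t > 0\<close> is a window of a single cyclic formula.\<close>

lemma left_index_late:
  assumes "n - 1 \<le> j" "0 < k" "k < n"
  shows "left_index n k j = (k + 1 + j) mod n"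
proof (cases "j < n")
  case True
  then have j: "j = n - 1" and n: "1 < n" using assms by auto
  have "(k + j - 1) mod (n - 1) = k - 1"
  proof -
    have "k + j - 1 = (k - 1) + (n - 1)" using assms j by simp
    then show ?thesis using assms by (simp only: mod_add_self2) simp
  qed
  moreover have "(k + 1 + j) mod n = k" using assms j by simp
  ultimately show ?thesis using assms True j n by (simp add: left_index_def)
next
  case False
  then show ?thesis using assms by (simp add: left_index_def)
qed

section \<open>Blocks and the covering of all edges\<close>

text \<open>For \<open>t > 0\<close> the block is a window of length \<open>n\<close> of the cyclic
  formula; block 0 is \<open>0\<close> followed by a window of length \<open>n - 1\<close> modulo
  \<open>n - 1\<close>.\<close>

lemma left_index_aligned_block:
  assumes "u < n" "0 < k" "k < n"
  shows "\<exists>j. t * n \<le> j \<and> j < t * n + n \<and> left_index n k j = u"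
proof (cases "t = 0")
  case True
  show ?thesis
  proof (cases "u = 0")
    case True
    then show ?thesis using \<open>t = 0\<close> assms by (intro exI[of _ 0]) (auto simp: left_index_def)
  next
    case False
    then obtain j where "1 \<le> j" "j < 1 + (n - 1)" "((k - 1) + j) mod (n - 1) = u - 1"
      using ex_mod_eq_in_window[of "u - 1" "n - 1" 1 "k - 1"] assms by fastforce
    then show ?thesis using \<open>t = 0\<close> False assms
      by (intro exI[of _ j]) (auto simp: left_index_def)
  qed
next
  case False
  obtain j where "t * n \<le> j" "j < t * n + n" "(k + 1 + j) mod n = u"
    using ex_mod_eq_in_window[OF assms(1)] by blast
  moreover have "n \<le> t * n" using False by simp
  then have "n - 1 \<le> j" using \<open>t * n \<le> j\<close> by linarith
  ultimately have "left_index n k j = u" using assms by (simp only: left_index_late)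
  then show ?thesis using \<open>t * n \<le> j\<close> \<open>j < t * n + n\<close> by blast
qed

lemma left_index_shifted_block:
  assumes "u < n" "0 < k" "k < n" "0 < t"
  shows "\<exists>j. t * n - 1 \<le> j \<and> j < t * n + n - 1 \<and> left_index n k j = u"
proof -
  obtain j where j: "t * n - 1 \<le> j" "j < t * n - 1 + n" "(k + 1 + j) mod n = u"
    using ex_mod_eq_in_window[OF assms(1)] by blast
  have "n \<le> t * n" using assms by simp
  then have "n - 1 \<le> j" using j by linarith
  then have "left_index n k j = u" using j assms by (simp only: left_index_late)
  moreover have "j < t * n + n - 1" using j \<open>n \<le> t * n\<close> assms by linarith
  ultimately show ?thesis using j by blast
qed

text \<open>Step \<open>j\<close> leads from position \<open>j\<close> to the cyclically next one
  through \<open>right_index n k j\<close>. The steps through a fixed \<open>v\<close> pair up the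
  positions of one block, and that block contains every \<open>u\<close>.\<close>

lemma index_pair_covered:
  assumes n: "n = 2 * s" and k: "0 < k" "k < n" and u: "u < n" and v: "v < n"
  shows "\<exists>j < s * n. right_index n k j = v \<and>
           (left_index n k j = u \<or> left_index n k (Suc j mod (s * n)) = u)"
proof -
  \<comment> \<open>Undoes the rotation by \<open>k\<close>: half of \<open>r\<close> is the block
    number, its parity tells aligned from shifted.\<close>
  define r where "r = (v + (n - k)) mod n"
  have r: "r < n" and rv: "(r + k) mod n = v"
    using k v by (auto simp: r_def mod_add_left_eq)
  define t where "t = r div 2"
  have t: "t < s" using r n by (auto simp: t_def)
  have tn: "t * n + n \<le> s * n" using mult_le_mono1[of "Suc t" s n] t by simp
  have even_n: "even (t * n)" "even n" "even (s * n)" using n by auto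
  have "n \<le> s * n" using t by simp
  have right: "right_index n k j = v" if "(j + 1) div n = t" "j mod 2 = r mod 2" for j
    using that rv by (simp add: right_index_def t_def)
  have div_eq: "i div n = t" if "t * n \<le> i" "i < t * n + n" for i
    using that by (intro div_nat_eqI) (auto simp: mult.commute)
  show ?thesis
  proof (cases "even r")
    case True
    obtain j where j: "t * n \<le> j" "j < t * n + n" "left_index n k j = u"
      using left_index_aligned_block[OF u k] by blast
    show ?thesis
    \<comment> \<open>In an aligned block an even position starts a step through \<open>v\<close>,
      an odd one ends it.\<close>
    proof (cases "even j")
      case True
      have "even (t * n + n)" "odd (j + 1)" using True even_n by simp_all
      then have "j + 1 \<noteq> t * n + n" by metis
      then have next_less: "j + 1 < t * n + n" using j by linarith
      have "right_index n k j = v"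
        using j True \<open>even r\<close> next_less by (intro right div_eq) auto
      then show ?thesis using j tn by (intro exI[of _ j]) auto
    next
      case False
      then obtain i where i: "j = Suc i" "even i" by (auto elim!: oddE)
      then have "right_index n k i = v"
        using j \<open>even r\<close> by (intro right div_eq) auto
      then show ?thesis using i j tn by (intro exI[of _ i]) auto
    qed
  next
    case False
    \<comment> \<open>In a shifted block the odd positions start the steps and the even ones end
      them.\<close>
    have odd_case: ?thesis if "j < s * n" "t * n \<le> j + 1" "j + 1 < t * n + n"
      "left_index n k j = u" "odd j" for j
    proof -
      have "right_index n k j = v"
        using that False by (intro right div_eq) (auto simp: odd_iff_mod_2_eq_one)
      then show ?thesis using that by (intro exI[of _ j]) auto
    qed
    have even_case: ?thesis if *: "0 < j" "t * n \<le> j" "j < t * n + n"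
      "left_index n k j = u" "even j" for j
    proof -
      obtain i where i: "j = Suc i" "odd i" using * by (cases j) auto
      then have "right_index n k i = v"
        using that False by (intro right div_eq) (auto simp: odd_iff_mod_2_eq_one)
      then show ?thesis using i that tn by (intro exI[of _ i]) auto
    qed
    show ?thesis
    proof (cases "t = 0")
      case True
      have r1: "r = 1" using True False by (auto simp: t_def elim!: oddE)
      \<comment> \<open>The quotient is \<open>s\<close> here and contributes
        \<open>2 * s = n\<close>, which vanishes modulo \<open>n\<close>: the last step belongs to
        shifted block 0.\<close>
      have last: "right_index n k (s * n - 1) = v"
      proof -
        have "(s * n - 1) mod 2 = 1"
        proof -
          have "0 < s * n" using t k by simp
          then have "odd (s * n - 1)" using even_n by (simp only: even_diff_nat) simp
          then show ?thesis by (simp only: odd_iff_mod_2_eq_one)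
        qed
        then have "right_index n k (s * n - 1) = (n + (1 + k)) mod n"
          using n t k by (simp add: right_index_def add_ac)
        then show ?thesis using rv r1 by (simp only: mod_add_self1)
      qed
      \<comment> \<open>Aligned block 0 can be searched instead: the cyclic shifted block 0 has
        position \<open>s * n - 1\<close> in place of \<open>n - 1\<close>, and both carry
        \<open>k\<close>.\<close>
      obtain j where j: "j < n" "left_index n k j = u"
        using left_index_aligned_block[OF u k, of 0] by auto
      consider "j = 0" | "j = n - 1" | "0 < j" "j < n - 1" using j by linarith
      then show ?thesis
      proof cases
        case 1
        then show ?thesis using j last k \<open>n \<le> s * n\<close> by (intro exI[of _ "s * n - 1"]) auto
      next
        case 2
        have "left_index n k (s * n - 1) = left_index n k (n - 1)"
        proof -
          have "n - 1 \<le> s * n - 1" "k + 1 + (s * n - 1) = k + s * n"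
            "k + 1 + (n - 1) = k + n"
            using k \<open>n \<le> s * n\<close> by linarith+
          then have "left_index n k (s * n - 1) = (k + s * n) mod n"
            "left_index n k (n - 1) = (k + n) mod n"
            using k by (simp_all only: left_index_late order_refl)
          then show ?thesis by simp
        qed
        then show ?thesis using 2 j last k \<open>n \<le> s * n\<close> by (intro exI[of _ "s * n - 1"]) auto
      next
        case 3
        then have "t * n \<le> j" "j + 1 < t * n + n" using True by simp_all
        moreover from this have "j < s * n" "j < t * n + n" using tn by linarith+
        ultimately show ?thesis using 3 j even_case[of j] odd_case[of j]
          by (cases "even j") (simp_all only: not_False_eq_True simp_thms trans_le_add1)
      qed
    next
      case False
      obtain j where j: "t * n - 1 \<le> j" "j < t * n + n - 1" "left_index n k j = u"
        using left_index_shifted_block[OF u k] False by blast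
      show ?thesis
      proof (cases "even j")
        case True
        have "0 < t * n" using False k by simp
        then have "odd (t * n - 1)" using even_n by simp
        then have "j \<noteq> t * n - 1" using True by blast
        then have "t * n \<le> j" "0 < j" "j < t * n + n" using j \<open>0 < t * n\<close> by linarith+
        then show ?thesis using j True by (intro even_case)
      next
        case False
        moreover have "j < s * n" "t * n \<le> j + 1" "j + 1 < t * n + n" using j tn k by linarith+
        ultimately show ?thesis using j by (intro odd_case[of j])
      qed
    qed
  qed
qed

section \<open>Edge lists of walks, and the circuits as vertex lists\<close>

lemma length_walk_edges: "length (walk_edges c) = length c - 1"
  by (induction c rule: walk_edges.induct) auto

lemma nth_walk_edges: "Suc i < length c \<Longrightarrow> walk_edges c ! i = {c ! i, c ! Suc i}"
  by (induction c arbitrary: i rule: walk_edges.induct) (auto simp: nth_Cons split: nat.split)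

lemma eulerian_circuit_length:
  assumes "eulerian_circuit G x c"
  shows "length c = Suc (card (edges G))"
proof -
  have "card (edges G) = length c - 1"
    using assms distinct_card[of "walk_edges c"]
    by (simp add: eulerian_circuit_def trail_def length_walk_edges)
  moreover have "c \<noteq> []" using assms by (simp add: eulerian_circuit_def trail_def walk_def)
  ultimately show ?thesis by (cases c) auto
qed

text \<open>
  The maps \<open>f\<close> and \<open>g\<close> number the side of the base vertex \<open>f 0\<close> and the opposite side.
\<close>

definition circuit_vertex :: "(nat \<Rightarrow> 'a) \<Rightarrow> (nat \<Rightarrow> 'a) \<Rightarrow> nat \<Rightarrow> nat \<Rightarrow> nat \<Rightarrow> 'a" where
  "circuit_vertex f g n k i =
     (if even i then f (left_index n k (i div 2)) else g (right_index n k (i div 2)))"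

definition circuit :: "(nat \<Rightarrow> 'a) \<Rightarrow> (nat \<Rightarrow> 'a) \<Rightarrow> nat \<Rightarrow> nat \<Rightarrow> 'a list" where
  "circuit f g n k = map (circuit_vertex f g n k) [0..<n * n] @ [f 0]"

lemma length_circuit: "length (circuit f g n k) = Suc (n * n)"
  by (simp add: circuit_def)

lemma nth_circuit: "i < n * n \<Longrightarrow> circuit f g n k ! i = circuit_vertex f g n k i"
  by (simp add: circuit_def nth_append)

lemma nth_circuit_last: "circuit f g n k ! (n * n) = f 0"
  by (simp add: circuit_def nth_append)

lemma circuit_even:
  assumes "n = 2 * s" "j < s * n"
  shows "circuit f g n k ! (2 * j) = f (left_index n k j)"
  using assms by (subst nth_circuit) (auto simp: circuit_vertex_def)

lemma circuit_odd:
  assumes "n = 2 * s" "j < s * n"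
  shows "circuit f g n k ! Suc (2 * j) = g (right_index n k j)"
  using assms by (subst nth_circuit) (auto simp: circuit_vertex_def)

text \<open>The closing entry \<open>f 0\<close> acts as position 0, whence the index modulo
  \<open>s * n\<close>.\<close>

lemma circuit_even_Suc:
  assumes "n = 2 * s" "j < s * n"
  shows "circuit f g n k ! Suc (Suc (2 * j)) = f (left_index n k (Suc j mod (s * n)))"
proof (cases "Suc j = s * n")
  case True
  then have "Suc (Suc (2 * j)) = n * n" using assms by simp
  then show ?thesis using True by (simp add: nth_circuit_last left_index_def)
next
  case False
  then show ?thesis using circuit_even[of n s "Suc j"] assms by simp
qed

section \<open>Both bounds for a fixed base vertex\<close>

text \<open>Abstract numberings let one argument serve base vertices on either side.\<close>

locale balanced_bipartite =
  fixes G :: "'a graph" and f g :: "nat \<Rightarrow> 'a" and s n :: nat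
  assumes s: "1 \<le> s" and n: "n = 2 * s"
    and verts: "verts G = f ` {..<n} \<union> g ` {..<n}"
    and edges: "edges G = {{f i, g j} | i j. i < n \<and> j < n}"
    and inj_f: "inj_on f {..<n}" and inj_g: "inj_on g {..<n}"
    and disj: "f ` {..<n} \<inter> g ` {..<n} = {}"
begin

lemma sides_neq: "i < n \<Longrightarrow> j < n \<Longrightarrow> f i \<noteq> g j"
  using disj by blast

lemma card_edges: "card (edges G) = n * n"
proof -
  have "edges G = (\<lambda>(i, j). {f i, g j}) ` ({..<n} \<times> {..<n})"
    by (auto simp: edges)
  moreover have "inj_on (\<lambda>(i, j). {f i, g j}) ({..<n} \<times> {..<n})"
    using inj_f inj_g sides_neq
    by (auto simp: inj_on_def doubleton_eq_iff)
  ultimately show ?thesis by (simp add: card_image)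
qed

lemma not_adjacent_left: "i < n \<Longrightarrow> j < n \<Longrightarrow> \<not> adjacent G (f i) (f j)"
  using sides_neq by (auto simp: adjacent_def edges doubleton_eq_iff)

lemma not_adjacent_right:
  assumes "i < n" "j < n"
  shows "\<not> adjacent G (g i) (g j)"
proof
  assume "adjacent G (g i) (g j)"
  then obtain a b where "{g i, g j} = {f a, g b}" "a < n"
    by (auto simp: adjacent_def edges)
  then have "f a = g i \<or> f a = g j" by (auto simp: doubleton_eq_iff)
  then show False using sides_neq \<open>a < n\<close> assms by blast
qed

text \<open>All edges occur by \<open>index_pair_covered\<close>; as the walk has exactly
  \<open>card (edges G)\<close> steps, none repeats.\<close>

lemma eulerian_circuit_circuit:
  assumes k: "0 < k" "k < n"
  shows "eulerian_circuit G (f 0) (circuit f g n k)"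
proof -
  let ?c = "circuit f g n k"
  have n2: "2 \<le> n" using s n by simp
  have left_less: "left_index n k i < n" and right_less: "right_index n k i < n" for i
    using n2 by (simp_all add: left_index_less right_index_less)
  have len: "length (walk_edges ?c) = n * n"
    by (simp add: length_walk_edges length_circuit)
  have step: "walk_edges ?c ! i = {?c ! i, ?c ! Suc i}" if "i < n * n" for i
    using that by (simp add: nth_walk_edges length_circuit)
  have sub: "set (walk_edges ?c) \<subseteq> edges G"
  proof
    fix e assume "e \<in> set (walk_edges ?c)"
    then obtain i where i: "i < n * n" "e = {?c ! i, ?c ! Suc i}"
      using step len by (auto simp: in_set_conv_nth)
    define j where "j = i div 2"
    have j: "j < s * n" using i n by (auto simp: j_def)
    consider "i = 2 * j" | "i = Suc (2 * j)" unfolding j_def by linarith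
    then show "e \<in> edges G"
    proof cases
      case 1
      then have "e = {f (left_index n k j), g (right_index n k j)}"
        using i by (simp add: circuit_even[OF n j] circuit_odd[OF n j])
      then show ?thesis using left_less right_less unfolding edges by blast
    next
      case 2
      then have "e = {f (left_index n k (Suc j mod (s * n))), g (right_index n k j)}"
        using i by (auto simp: circuit_even_Suc[OF n j] circuit_odd[OF n j])
      then show ?thesis using left_less right_less unfolding edges by blast
    qed
  qed
  have sup: "edges G \<subseteq> set (walk_edges ?c)"
  proof
    fix e assume "e \<in> edges G"
    then obtain u v where e: "e = {f u, g v}" "u < n" "v < n" by (auto simp: edges)
    obtain j where j: "j < s * n" and v: "right_index n k j = v"
      and u: "left_index n k j = u \<or> left_index n k (Suc j mod (s * n)) = u"
      using index_pair_covered[OF n k e(2,3)] by blast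
    have i: "2 * j < n * n" "Suc (2 * j) < n * n" using j n by auto
    have "\<exists>i < n * n. e = {?c ! i, ?c ! Suc i}"
      using u
    proof
      assume "left_index n k j = u"
      then show ?thesis using i e v
        by (intro exI[of _ "2 * j"]) (simp add: circuit_even[OF n j] circuit_odd[OF n j])
    next
      assume "left_index n k (Suc j mod (s * n)) = u"
      then show ?thesis using i e v
        by (intro exI[of _ "Suc (2 * j)"])
          (auto simp: circuit_even_Suc[OF n j] circuit_odd[OF n j])
    qed
    then show "e \<in> set (walk_edges ?c)" using step len by (metis nth_mem)
  qed
  have "distinct (walk_edges ?c)"
    using sub sup len card_edges by (intro card_distinct) simp
  moreover have "set ?c \<subseteq> verts G"
    using n2 by (auto simp: circuit_def circuit_vertex_def verts left_index_less right_index_less)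
  moreover have "hd ?c = f 0" "last ?c = f 0"
    using n2 by (auto simp: circuit_def hd_append hd_map circuit_vertex_def left_index_def)
  ultimately show ?thesis using sub sup
    by (auto simp: eulerian_circuit_def trail_def walk_def circuit_def)
qed

text \<open>At each position both circuits are on the same side, where nothing is adjacent, so
  injectivity of the indices in \<open>k\<close> suffices. Excluding \<open>i = 0\<close> supplies
  the condition \<open>0 < j\<close> of \<open>left_index_inj\<close>.\<close>

lemma avoiding_circuits:
  assumes "0 < k" "k < n" "0 < l" "l < n" "k \<noteq> l"
  shows "avoiding G (circuit f g n k) (circuit f g n l)"
  unfolding avoiding_def
proof
  fix i assume "i \<in> {1..card (edges G) - 1}"
  then have i: "0 < i" "i < n * n" by (auto simp: card_edges)
  have n2: "2 \<le> n" using s n by simp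
  show "circuit f g n k ! i \<noteq> circuit f g n l ! i \<and>
      \<not> adjacent G (circuit f g n k ! i) (circuit f g n l ! i)"
  proof (cases "even i")
    case True
    then have "0 < i div 2" using i by auto
    then have "left_index n k (i div 2) \<noteq> left_index n l (i div 2)"
      using left_index_inj assms by blast
    then show ?thesis
      using i True n2 inj_f left_index_less not_adjacent_left
      by (simp add: nth_circuit circuit_vertex_def inj_on_eq_iff)
  next
    case False
    have "right_index n k (i div 2) \<noteq> right_index n l (i div 2)"
      using right_index_inj assms by blast
    then show ?thesis
      using i False n2 inj_g right_index_less not_adjacent_right
      by (simp add: nth_circuit circuit_vertex_def inj_on_eq_iff)
  qed
qed

lemma ex_avoiding_circuits:
  "\<exists>C. finite C \<and> card C = n - 1 \<and> (\<forall>c\<in>C. eulerian_circuit G (f 0) c) \<and> mutually_avoiding G C"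
proof -
  let ?C = "circuit f g n ` {1..<n}"
  \<comment> \<open>The range of compared positions is therefore nonempty, so no circuit avoids
    itself.\<close>
  have four: "4 \<le> n * n" using s n mult_le_mono[of 2 n 2 n] by simp
  have "inj_on (circuit f g n) {1..<n}"
  proof (rule inj_onI, rule ccontr)
    fix k l assume kl: "k \<in> {1..<n}" "l \<in> {1..<n}" "circuit f g n k = circuit f g n l" "k \<noteq> l"
    then have "avoiding G (circuit f g n k) (circuit f g n l)"
      by (intro avoiding_circuits) auto
    then show False using four kl(3) by (auto simp: avoiding_def card_edges)
  qed
  then have "card ?C = n - 1" by (simp add: card_image)
  moreover have "mutually_avoiding G ?C"
    unfolding mutually_avoiding_def pairwise_def
    by (auto intro!: avoiding_circuits)
  ultimately show ?thesis
    by (intro exI[of _ ?C]) (auto intro!: eulerian_circuit_circuit)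
qed

lemma avoiding_circuits_card_le:
  assumes C: "\<forall>c\<in>C. eulerian_circuit G (f 0) c" "mutually_avoiding G C"
  shows "card C \<le> n - 1"
proof -
  \<comment> \<open>Position 2 is therefore among the compared ones.\<close>
  have four: "4 \<le> n * n" using s n mult_le_mono[of 2 n 2 n] by simp
  have "inj_on (\<lambda>c. c ! 2) C"
  proof (rule inj_onI, rule ccontr)
    fix c d assume "c \<in> C" "d \<in> C" "c ! 2 = d ! 2" "c \<noteq> d"
    moreover from this have "avoiding G c d"
      using C(2) by (auto simp: mutually_avoiding_def pairwise_def)
    ultimately show False using four by (auto simp: avoiding_def card_edges)
  qed
  moreover have "(\<lambda>c. c ! 2) ` C \<subseteq> f ` {1..<n}"
  proof clarify
    fix c assume "c \<in> C"
    then have c: "eulerian_circuit G (f 0) c" using C by blast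
    then have len: "length c = Suc (n * n)" using eulerian_circuit_length card_edges by metis
    then have "c \<noteq> []" by auto
    then have c0: "c ! 0 = f 0"
      using c hd_conv_nth[of c] by (auto simp: eulerian_circuit_def)
    have n0: "0 < n" using s n by simp
    have w: "walk_edges c ! 0 = {c ! 0, c ! 1}" "walk_edges c ! 1 = {c ! 1, c ! 2}"
      using len four n0 nth_walk_edges[of 0 c] nth_walk_edges[of 1 c]
      by (simp_all add: numeral_2_eq_2)
    have lw: "1 < length (walk_edges c)" using len four by (simp add: length_walk_edges)
    then have "walk_edges c ! 0 \<in> set (walk_edges c)" "walk_edges c ! 1 \<in> set (walk_edges c)"
      by (auto intro!: nth_mem)
    then have e: "{c ! 0, c ! 1} \<in> edges G" "{c ! 1, c ! 2} \<in> edges G"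
      using c w by (auto simp: eulerian_circuit_def)
    have "walk_edges c \<noteq> []" using lw by auto
    then have "walk_edges c ! 0 \<noteq> walk_edges c ! 1"
      using c lw nth_eq_iff_index_eq[of "walk_edges c" 0 1]
      by (auto simp: eulerian_circuit_def trail_def)
    \<comment> \<open>Returning to \<open>f 0\<close> would repeat the first edge.\<close>
    then have "c ! 2 \<noteq> f 0" using w c0 by auto
    obtain j where j: "j < n" "c ! 1 = g j"
      using e(1) c0 sides_neq[OF n0] by (auto simp: edges doubleton_eq_iff)
    obtain i where i: "i < n" "c ! 2 = f i"
      using e(2) j sides_neq by (auto simp: edges doubleton_eq_iff) metis
    then show "c ! 2 \<in> f ` {1..<n}" using \<open>c ! 2 \<noteq> f 0\<close>
      by (cases "i = 0") auto
  qed
  ultimately have "card C \<le> card (f ` {1..<n})" by (rule card_inj_on_le) simp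
  also have "\<dots> \<le> n - 1" using card_image_le[of "{1..<n}" f] by simp
  finally show ?thesis .
qed

end

section \<open>Transfer to complete bipartite graphs\<close>

lemma doubletons_reindex:
  fixes n :: nat and F H :: "nat \<Rightarrow> 'a"
  assumes p: "p ` {..<n} = {..<n}"
  shows "{{F (p a), H b} | a b. a < n \<and> b < n} = {{F a, H b} | a b. a < n \<and> b < n}"
proof (intro equalityI subsetI)
  fix e assume "e \<in> {{F (p a), H b} | a b. a < n \<and> b < n}"
  then obtain a b where e: "e = {F (p a), H b}" "a < n" "b < n" by blast
  then have "p a < n" using p by blast
  then show "e \<in> {{F a, H b} | a b. a < n \<and> b < n}" using e by blast
next
  fix e assume "e \<in> {{F a, H b} | a b. a < n \<and> b < n}"
  then obtain a b where e: "e = {F a, H b}" "a < n" "b < n" by blast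
  then have "a \<in> p ` {..<n}" using p by blast
  then obtain a' where "a = p a'" "a' < n" by blast
  then show "e \<in> {{F (p a), H b} | a b. a < n \<and> b < n}" using e by blast
qed

text \<open>The transposition gives number 0 to \<open>Inl i\<close>, making the base vertex
  arbitrary on its side.\<close>

lemma balanced_bipartite_complete_Inl:
  assumes "1 \<le> s" "n = 2 * s" "i < n"
  shows "balanced_bipartite (complete_bipartite n n) (Inl \<circ> transpose 0 i) Inr s n"
proof
  have T: "transpose 0 i ` {..<n} = {..<n}" using assms by (intro transpose_image_eq) auto
  show "verts (complete_bipartite n n) = (Inl \<circ> transpose 0 i) ` {..<n} \<union> Inr ` {..<n}"
    by (simp only: image_comp[symmetric] T) (simp add: complete_bipartite_def)
  show "edges (complete_bipartite n n) =
      {{(Inl \<circ> transpose 0 i) a, Inr b} | a b. a < n \<and> b < n}"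
    using doubletons_reindex[OF T, of Inl Inr] by (simp add: complete_bipartite_def)
qed (use assms in \<open>auto intro!: inj_onI dest: transpose_eq_imp_eq\<close>)

lemma balanced_bipartite_complete_Inr:
  assumes "1 \<le> s" "n = 2 * s" "i < n"
  shows "balanced_bipartite (complete_bipartite n n) (Inr \<circ> transpose 0 i) Inl s n"
proof
  have T: "transpose 0 i ` {..<n} = {..<n}" using assms by (intro transpose_image_eq) auto
  show "verts (complete_bipartite n n) = (Inr \<circ> transpose 0 i) ` {..<n} \<union> Inl ` {..<n}"
    by (simp only: image_comp[symmetric] T) (simp add: complete_bipartite_def Un_commute)
  have "{{Inl a, Inr b} | a b. a < n \<and> b < n} =
      {{Inr a, Inl b :: nat + nat} | a b. a < n \<and> b < n}"
    by (metis (no_types, lifting) insert_commute)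
  then show "edges (complete_bipartite n n) =
      {{(Inr \<circ> transpose 0 i) a, Inl b} | a b. a < n \<and> b < n}"
    using doubletons_reindex[OF T, of Inr Inl] by (simp add: complete_bipartite_def)
qed (use assms in \<open>auto intro!: inj_onI dest: transpose_eq_imp_eq\<close>)

theorem theorem10:
  fixes s :: nat
  assumes "s \<ge> 1"
  shows "avoidance_index (complete_bipartite (2 * s) (2 * s)) = 2 * s - 1"
  unfolding avoidance_index_def
proof (rule Greatest_equality)
  let ?G = "complete_bipartite (2 * s) (2 * s)"
  let ?P = "\<lambda>x k. \<exists>C. finite C \<and> card C = k \<and>
    (\<forall>c\<in>C. eulerian_circuit ?G x c) \<and> mutually_avoiding ?G C"
  show "\<forall>x\<in>verts ?G. ?P x (2 * s - 1)"
  proof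
    fix x assume "x \<in> verts ?G"
    then consider i where "i < 2 * s" "x = Inl i" | i where "i < 2 * s" "x = Inr i"
      by (auto simp: complete_bipartite_def)
    then show "?P x (2 * s - 1)"
    proof cases
      case 1
      then show ?thesis
        using balanced_bipartite.ex_avoiding_circuits[OF balanced_bipartite_complete_Inl, of s _ i] assms
        by simp
    next
      case 2
      then show ?thesis
        using balanced_bipartite.ex_avoiding_circuits[OF balanced_bipartite_complete_Inr, of s _ i] assms
        by simp
    qed
  qed
  fix k assume "\<forall>x\<in>verts ?G. ?P x k"
  \<comment> \<open>A single base vertex suffices for the upper bound.\<close>
  moreover have "Inl 0 \<in> verts ?G" using assms by (simp add: complete_bipartite_def)
  ultimately have "?P (Inl 0) k" by blast
  then show "k \<le> 2 * s - 1"
    using balanced_bipartite.avoiding_circuits_card_le[OF balanced_bipartite_complete_Inl, of s _ 0] assms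
    by auto
qed

end
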